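(* Let $\mathfrak g$ be a classical Lie algebra over $\mathbb C$ of rank $n$ and let $\mathfrak p\subset\mathfrak g$ be a nice standard parabolic subalgebra given by its sequence of block lengths. Let $S_1$ be the set of roots involved in the element $X_R$ constructed for $\mathfrak p$ (as described in the context). If $\mathfrak g$ is a special linear or a symplectic Lie algebra, or if $\mathfrak g$ is orthogonal and $\mathfrak p$ is not of the form ( * ), then $S_1$ consists of at most $n$ roots.
   Context: **Setup.** $J_m$ is the $m\times m$ matrix with entries $1$ on the skew-diagonal and $0$ elsewhere. Realizations: $\mathfrak{sl}_{n+1}$ (type $A_n$) is the trace zero matrices; $\mathfrak{so}_N=\{A=(a_{ij}) : a_{N+1-j,N+1-i}=-a_{ij}\}$ (type $B_n$ for $N=2n+1$, $D_n$ for $N=2n$); $\mathfrak{sp}_{2n}$ (type $C_n$) is the symplectic Lie algebra of the form with matrix $\begin{bmatrix}0&J_n\\ -J_n&0\end{bmatrix}$. The Cartan subalgebra is the diagonal matrices in $\mathfrak g$, the Borel subalgebra the upper triangular matrices in $\mathfrak g$; roots are taken with respect to this Cartan subalgebra. A standard parabolic subalgebra $\mathfrak p$ is described by the sequence of block lengths of its standard Levi factor: $\mathfrak p$ is the set of block upper triangular matrices in $\mathfrak g$ for this sequence. For $\mathfrak{so}_{2n}$ the sequences $(\dots,1,1,\dots)$ and $(\dots,2,\dots)$ (two central blocks of length 1, resp. one central block of length 2) give the same parabolic, and the second description is always used. $\mathfrak g=\bigoplus_j\mathfrak g_j$, where $\mathfrak g_j$ is the set of matrices in $\mathfrak g$ supported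 on the $j$-th block (super)diagonal; $\mathfrak p=\bigoplus_{j\ge0}\mathfrak g_j$, $\mathfrak n=\bigoplus_{j>0}\mathfrak g_j$; $\mathfrak g_1$ consists of rectangles $R_{i,i+1}$ ($a_i\times a_{i+1}$) on the first block superdiagonal. $\mathfrak p$ is nice if there is $X\in\mathfrak g_1$ with $[\mathfrak p,X]=\mathfrak n$. **Block sequences.** For $\mathfrak{sl}_{n+1}$: $(a_1,\dots,a_{r+1})$. For $\mathfrak{so}_N$, $\mathfrak{sp}_{2n}$: case (A) $(a_1,\dots,a_r,a_r,\dots,a_1)$ or case (B) $(a_1,\dots,a_r,a_{r+1},a_r,\dots,a_1)$. Unimodal means first weakly increasing, then weakly decreasing. By the known classification, if $\mathfrak p$ is nice then the sequence is unimodal, or $\mathfrak g$ is orthogonal and $a_1\le\dots\le a_l>a_{l+1}=\dots=a_r$ (case (A)), resp. $a_1\le\dots\le a_l>a_{l+1}=\dots=a_{r+1}$ (case (B)), with $a_l=a_{l+1}+1$. Put $B_i=\lceil a_i/2\rceil$, $b_i=\lfloor a_i/2\rfloor$. **Construction of $X_R$.** The displayed $J$'s sit in the indicated corners of the rectangle and all other entries are zero. *Type A.* For $1\le i\le r$: if $a_i\le a_{i+1}$, $R_{i,i+1}=\begin{bmatrix}J_{a_i}&0\end{bmatrix}$ ($i$ odd), $\begin{bmatrix}0&J_{a_i}\end{bmatrix}$ ($i$ even); if $a_i>a_{i+1}$, $R_{i,i+1}=\begin{bmatrix}0\\ J_{a_{i+1}}\end{bmatrix}$ ($i$ odd), $\begin{bmatrix}J_{a_{i+1}}\\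 0\end{bmatrix}$ ($i$ even). *Type C, case (A).* For $i\le r-1$, $R_{i,i+1}=\begin{bmatrix}J_{a_i}&0\end{bmatrix}$ ($i$ odd), $\begin{bmatrix}0&J_{a_i}\end{bmatrix}$ ($i$ even); the central $a_r\times a_r$ square on the block superdiagonal is $R_r=J_{a_r}$. *Type C, case (B).* For $i\le r$, $R_{i,i+1}$ has $J_{b_i}$ in its upper right and $J_{B_i}$ in its lower left corner if $i$ is odd; $J_{B_i}$ in its upper right and $J_{b_i}$ in its lower left corner if $i$ is even. *Types B, D, case (A).* For $i\le r-1$ the same rectangles $R_{i,i+1}$ as in type A. The central $a_r\times a_r$ square $R_r$ has $b_r$ blocks $\begin{bmatrix}1&0\\ 0&-1\end{bmatrix}$ along the skew-diagonal, the $k$-th one ($1\le k\le b_r$) in rows $a_r+1-2k,a_r+2-2k$ and columns $2k-1,2k$ if $r$ is odd, and in rows $2k-1,2k$ and columns $a_r+1-2k,a_r+2-2k$ if $r$ is even. *Types B, D, case (B).* For $i\le r$: - $a_i,a_{i+1}$ of the same parity: $R_{i,i+1}=\begin{bmatrix}0&J_{a_i}&0\end{bmatrix}$ with $(a_{i+1}-a_i)/2$ zero columns on each side; - $a_i=a_{i+1}+1$, $a_i$ even: $J_{B_i-1}$ in the upper right and $J_{B_i}$ in the lower left corner if $i$ is odd; $J_{B_i}$ in the upper right and $J_{B_i-1}$ in the lower left corner if $i$ is even (one zero row between them); - all other cases: $J_{B_i}$ in the upper right and $J_{B_i}$ in the lower left corner (entries $1$ at $(p,a_{i+1}+1-p)$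 and at $(a_i+1-p,p)$ for $1\le p\le B_i$). Exception: for $\mathfrak g=\mathfrak{so}_{2n+1}$ with $a_l>a_{l+1}$, $a_{l-1}$ odd and $a_{l-1}=a_{l+1}$, the rectangle $R_{l-1,l}$ is instead the one with $J_{b_{l-1}}$ in the upper right and $J_{B_{l-1}}$ in the lower left corner if $l-1$ is odd, and with $J_{B_{l-1}}$ in the upper right and $J_{b_{l-1}}$ in the lower left corner if $l-1$ is even. In types B, C, D, $X_R\in\mathfrak g_1$ has the given rectangles in the upper left half of the block superdiagonal, $R_r$ in the central position in case (A), and the lower right half is determined by $X_R\in\mathfrak g$. **Roots.** $S_1$ is the set of roots $\alpha$ of $\mathfrak g$ such that $X_R$ has a nonzero component in the root space $\mathfrak g_\alpha$. **Form ( * ).** A nice parabolic subalgebra $\mathfrak p\subset\mathfrak{so}_N$ with an odd number of blocks $(a_1,\dots,a_r,a_{r+1},a_r,\dots,a_1)$ is of the form ( * ) if one of these holds: (1) the sequence is unimodal and there is $i<r$ with $a_i$ odd and $a_{i+1}$ even; (2) $a_l>a_{l+1}$ for some $l$, and there is $i<l$ with $a_i$ odd, $a_{i+1}$ even, where if $i=l-1$ then moreover $a_{l-1}<a_{l+1}$; (3) $a_l>a_{l+1}$ for some $l$, and $a_l$ is odd. Parabolics with an even number of blocks are not of the form ( * ). *)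

theory Defs
  imports Complex_Main "HOL-Library.FuncSet" "Jordan_Normal_Form.Matrix"
begin

text \<open>Matrices over the complex numbers have \<^emph>\<open>0\<close>-based row and column indices. Block numbers
  and positions inside a rectangle are \<^emph>\<open>1\<close>-based where explicit entries are prescribed.\<close>

section \<open>Classical Lie algebras, roots\<close>

datatype lie_type = Type_A | Type_B | Type_C | Type_D

fun mat_size :: "lie_type \<Rightarrow> nat \<Rightarrow> nat" where
  "mat_size Type_A n = n + 1"
| "mat_size Type_B n = 2 * n + 1"
| "mat_size Type_C n = 2 * n"
| "mat_size Type_D n = 2 * n"

definition skew_unit :: "nat \<Rightarrow> complex mat" where
  "skew_unit m = mat m m (\<lambda>(i, j). if i + j + 1 = m then 1 else 0)"

definition symplectic_form :: "nat \<Rightarrow> complex mat" where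
  "symplectic_form n = four_block_mat (0\<^sub>m n n) (skew_unit n) (- skew_unit n) (0\<^sub>m n n)"

definition sl_alg :: "nat \<Rightarrow> complex mat set" where
  "sl_alg N = {A \<in> carrier_mat N N. (\<Sum>i<N. A $$ (i, i)) = 0}"

definition so_alg :: "nat \<Rightarrow> complex mat set" where
  "so_alg N = {A \<in> carrier_mat N N.
     \<forall>i<N. \<forall>j<N. A $$ (N - 1 - j, N - 1 - i) = - A $$ (i, j)}"

definition sp_alg :: "nat \<Rightarrow> complex mat set" where
  "sp_alg n = {A \<in> carrier_mat (2 * n) (2 * n).
     transpose_mat A * symplectic_form n + symplectic_form n * A = 0\<^sub>m (2 * n) (2 * n)}"

fun lie_alg :: "lie_type \<Rightarrow> nat \<Rightarrow> complex mat set" where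
  "lie_alg Type_A n = sl_alg (n + 1)"
| "lie_alg Type_B n = so_alg (2 * n + 1)"
| "lie_alg Type_C n = sp_alg n"
| "lie_alg Type_D n = so_alg (2 * n)"

definition bracket :: "complex mat \<Rightarrow> complex mat \<Rightarrow> complex mat" where
  "bracket A B = A * B - B * A"

definition cartan :: "lie_type \<Rightarrow> nat \<Rightarrow> complex mat set" where
  "cartan t n = {H \<in> lie_alg t n. diagonal_mat H}"

text \<open>Elements of the dual of the Cartan subalgebra are made extensional, so that a functional
  is determined by its values there and roots can be counted.\<close>

definition cartan_dual :: "lie_type \<Rightarrow> nat \<Rightarrow> (complex mat \<Rightarrow> complex) set" where
  "cartan_dual t n = {\<alpha> \<in> extensional (cartan t n).
     (\<forall>H\<in>cartan t n. \<forall>K\<in>cartan t n. \<alpha> (H + K) = \<alpha> H + \<alpha> K) \<and>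
     (\<forall>c. \<forall>H\<in>cartan t n. \<alpha> (c \<cdot>\<^sub>m H) = c * \<alpha> H)}"

definition root_space :: "lie_type \<Rightarrow> nat \<Rightarrow> (complex mat \<Rightarrow> complex) \<Rightarrow> complex mat set" where
  "root_space t n \<alpha> = {Y \<in> lie_alg t n. \<forall>H\<in>cartan t n. bracket H Y = \<alpha> H \<cdot>\<^sub>m Y}"

definition roots :: "lie_type \<Rightarrow> nat \<Rightarrow> (complex mat \<Rightarrow> complex) set" where
  "roots t n = {\<alpha> \<in> cartan_dual t n. (\<exists>H\<in>cartan t n. \<alpha> H \<noteq> 0) \<and>
     (\<exists>Y\<in>root_space t n \<alpha>. Y \<noteq> 0\<^sub>m (mat_size t n) (mat_size t n))}"

text \<open>\<open>X\<close> has a nonzero component in the root space of \<open>\<alpha>\<close>: in the root space decomposition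
  \<open>X = Z + (\<Sum>\<beta>\<in>F. Y \<beta>)\<close>, with \<open>Z\<close> in the Cartan subalgebra, the summand \<open>Y \<alpha>\<close> is nonzero. The sum
  is written entrywise because the matrix type is not a monoid.\<close>

definition has_root_component ::
    "lie_type \<Rightarrow> nat \<Rightarrow> complex mat \<Rightarrow> (complex mat \<Rightarrow> complex) \<Rightarrow> bool" where
  "has_root_component t n X \<alpha> \<longleftrightarrow> (let N = mat_size t n in
     \<exists>Z F Y. Z \<in> cartan t n \<and> finite F \<and> F \<subseteq> roots t n \<and> (\<forall>\<beta>\<in>F. Y \<beta> \<in> root_space t n \<beta>) \<and>
       (\<forall>i<N. \<forall>j<N. X $$ (i, j) = Z $$ (i, j) + (\<Sum>\<beta>\<in>F. Y \<beta> $$ (i, j))) \<and>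
       \<alpha> \<in> F \<and> Y \<alpha> \<noteq> 0\<^sub>m N N)"


section \<open>Standard parabolic subalgebras\<close>

text \<open>A parabolic subalgebra is given by its full list \<open>d\<close> of block lengths. The last condition
  excludes two central blocks of length 1 in type D: one central block of length 2 is used instead.\<close>

definition block_sequence :: "lie_type \<Rightarrow> nat \<Rightarrow> nat list \<Rightarrow> bool" where
  "block_sequence t n d \<longleftrightarrow> (\<forall>x\<in>set d. 1 \<le> x) \<and> sum_list d = mat_size t n \<and>
     (t \<noteq> Type_A \<longrightarrow> rev d = d) \<and>
     (t = Type_D \<longrightarrow> \<not> (even (length d) \<and> d ! (length d div 2 - 1) = 1))"

definition block_start :: "nat list \<Rightarrow> nat \<Rightarrow> nat" where
  "block_start d k = sum_list (take k d)"

text \<open>The number, counted from 0, of the block containing the (0-based) row or column \<open>i\<close>.\<close>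

definition block_of :: "nat list \<Rightarrow> nat \<Rightarrow> nat" where
  "block_of d i = (LEAST k. i < block_start d (k + 1))"

definition graded_piece :: "lie_type \<Rightarrow> nat \<Rightarrow> nat list \<Rightarrow> int \<Rightarrow> complex mat set" where
  "graded_piece t n d k = {A \<in> lie_alg t n. \<forall>i<mat_size t n. \<forall>j<mat_size t n.
     A $$ (i, j) \<noteq> 0 \<longrightarrow> int (block_of d j) - int (block_of d i) = k}"

definition parabolic :: "lie_type \<Rightarrow> nat \<Rightarrow> nat list \<Rightarrow> complex mat set" where
  "parabolic t n d = {A \<in> lie_alg t n. \<forall>i<mat_size t n. \<forall>j<mat_size t n.
     A $$ (i, j) \<noteq> 0 \<longrightarrow> block_of d i \<le> block_of d j}"

text \<open>The sum of the graded pieces of positive degree.\<close>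

definition nilradical :: "lie_type \<Rightarrow> nat \<Rightarrow> nat list \<Rightarrow> complex mat set" where
  "nilradical t n d = {A \<in> lie_alg t n. \<forall>i<mat_size t n. \<forall>j<mat_size t n.
     A $$ (i, j) \<noteq> 0 \<longrightarrow> block_of d i < block_of d j}"

definition nice :: "lie_type \<Rightarrow> nat \<Rightarrow> nat list \<Rightarrow> bool" where
  "nice t n d \<longleftrightarrow>
     (\<exists>X\<in>graded_piece t n d 1. (\<lambda>Y. bracket Y X) ` parabolic t n d = nilradical t n d)"

text \<open>The block length \<open>a\<^sub>i\<close>, with \<open>i\<close> counted from 1.\<close>

definition blk :: "nat list \<Rightarrow> nat \<Rightarrow> nat" where
  "blk d i = d ! (i - 1)"


section \<open>The element \<open>X\<^sub>R\<close>\<close>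

text \<open>Rectangles with entries 0 and 1 are given by the set of (1-based) positions of the ones.
  \<open>J_pos m s t\<close> is a skew-diagonal of length \<open>m\<close> with \<open>s\<close> rows above and \<open>t\<close> columns to the left;
  \<open>upper_right\<close> and \<open>lower_left\<close> place it in a corner of an \<open>a \<times> b\<close> rectangle. The other two
  corners only occur for a skew-diagonal of full height or width, where they coincide with one of
  these.\<close>

definition J_pos :: "nat \<Rightarrow> nat \<Rightarrow> nat \<Rightarrow> (nat \<times> nat) set" where
  "J_pos m s t = (\<lambda>k. (s + k, t + (m + 1 - k))) ` {1..m}"

definition upper_right :: "nat \<Rightarrow> nat \<Rightarrow> nat \<Rightarrow> (nat \<times> nat) set" where
  "upper_right a b m = J_pos m 0 (b - m)"

definition lower_left :: "nat \<Rightarrow> nat \<Rightarrow> nat \<Rightarrow> (nat \<times> nat) set" where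
  "lower_left a b m = J_pos m (a - m) 0"

text \<open>In the following, \<open>i\<close> is the number of the \<open>a \<times> b\<close> rectangle, which matters through its
  parity, and \<open>(a + 1) div 2\<close> and \<open>a div 2\<close> are the upper and lower halves of \<open>a\<close>.\<close>

definition rect_A :: "nat \<Rightarrow> nat \<Rightarrow> nat \<Rightarrow> (nat \<times> nat) set" where
  "rect_A i a b =
     (if a \<le> b then if odd i then lower_left a b a else upper_right a b a
      else if odd i then lower_left a b b else upper_right a b b)"

definition rect_halves :: "nat \<Rightarrow> nat \<Rightarrow> nat \<Rightarrow> (nat \<times> nat) set" where
  "rect_halves i a b =
     (if odd i then upper_right a b (a div 2) \<union> lower_left a b ((a + 1) div 2)
      else upper_right a b ((a + 1) div 2) \<union> lower_left a b (a div 2))"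

definition rect_C :: "nat list \<Rightarrow> nat \<Rightarrow> (nat \<times> nat) set" where
  "rect_C d i = (let a = blk d i; b = blk d (i + 1) in
     if even (length d) then if odd i then lower_left a b a else upper_right a b a
     else rect_halves i a b)"

text \<open>The exceptional rectangle \<open>R\<^bsub>l-1,l\<^esub>\<close> is recognised by \<open>i = l - 1\<close>.\<close>

definition rect_BD :: "lie_type \<Rightarrow> nat list \<Rightarrow> nat \<Rightarrow> (nat \<times> nat) set" where
  "rect_BD t d i = (let a = blk d i; b = blk d (i + 1); c = (a + 1) div 2 in
     if even (length d) then rect_A i a b
     else if t = Type_B \<and> i + 1 \<le> length d div 2 \<and> b > blk d (i + 2) \<and> odd a \<and> a = blk d (i + 2)
       then rect_halves i a b
     else if even a = even b then J_pos a 0 ((b - a) div 2)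
     else if a = b + 1 \<and> even a then
       (if odd i then upper_right a b (c - 1) \<union> lower_left a b c
        else upper_right a b c \<union> lower_left a b (c - 1))
     else upper_right a b c \<union> lower_left a b c)"

text \<open>The central \<open>m \<times> m\<close> square \<open>R\<^sub>r\<close> for an even number \<open>2 r\<close> of blocks in the orthogonal case.\<close>

definition central_D_entry :: "nat \<Rightarrow> nat \<Rightarrow> nat \<Rightarrow> nat \<Rightarrow> complex" where
  "central_D_entry r m p q =
     (if odd r then
        (if \<exists>k\<in>{1..m div 2}. p = m + 1 - 2 * k \<and> q = 2 * k - 1 then 1
         else if \<exists>k\<in>{1..m div 2}. p = m + 2 - 2 * k \<and> q = 2 * k then - 1 else 0)
      else
        (if \<exists>k\<in>{1..m div 2}. p = 2 * k - 1 \<and> q = m + 1 - 2 * k then 1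
         else if \<exists>k\<in>{1..m div 2}. p = 2 * k \<and> q = m + 2 - 2 * k then - 1 else 0))"

definition rect_entry :: "lie_type \<Rightarrow> nat list \<Rightarrow> nat \<Rightarrow> nat \<Rightarrow> nat \<Rightarrow> complex" where
  "rect_entry t d i p q =
     (if t = Type_A then of_bool ((p, q) \<in> rect_A i (blk d i) (blk d (i + 1)))
      else if 2 * i = length d then
        (if t = Type_C then of_bool ((p, q) \<in> J_pos (blk d i) 0 0)
         else central_D_entry i (blk d i) p q)
      else if t = Type_C then of_bool ((p, q) \<in> rect_C d i)
      else of_bool ((p, q) \<in> rect_BD t d i))"

text \<open>The reflection in the skew-diagonal sends an element of the Lie algebra to its negative, except
  that in type C the sign is opposite in the upper right and lower left \<open>n \<times> n\<close> quadrants. This gives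
  the lower right half of \<open>X\<^sub>R\<close> from the upper left half; that \<open>X\<^sub>R\<close> so defined belongs to
  the first graded piece of the Lie algebra is \<open>X_R_in_graded_piece\<close> below.\<close>

definition reflection_sign :: "lie_type \<Rightarrow> nat \<Rightarrow> nat \<Rightarrow> nat \<Rightarrow> complex" where
  "reflection_sign t n i j = (if t = Type_C \<and> (i < n) \<noteq> (j < n) then 1 else - 1)"

definition block_entry :: "lie_type \<Rightarrow> nat list \<Rightarrow> nat \<Rightarrow> nat \<Rightarrow> complex" where
  "block_entry t d i j = rect_entry t d (block_of d i + 1)
     (i - block_start d (block_of d i) + 1) (j - block_start d (block_of d j) + 1)"

definition X_R :: "lie_type \<Rightarrow> nat \<Rightarrow> nat list \<Rightarrow> complex mat" where
  "X_R t n d = (let N = mat_size t n in mat N N (\<lambda>(i, j).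
     if block_of d j \<noteq> block_of d i + 1 then 0
     else if t = Type_A \<or> 2 * (block_of d i + 1) \<le> length d then block_entry t d i j
     else reflection_sign t n i j * block_entry t d (N - 1 - j) (N - 1 - i)))"

subsection \<open>Membership in the first graded piece\<close>

lemma block_start_mono: "k \<le> l \<Longrightarrow> block_start d k \<le> block_start d l"
proof -
  assume "k \<le> l"
  then have "take l d = take k d @ take (l - k) (drop k d)"
    by (metis le_add_diff_inverse take_add)
  then show ?thesis by (simp add: block_start_def)
qed

lemma block_start_Suc: "k < length d \<Longrightarrow> block_start d (Suc k) = block_start d k + d ! k"
  by (simp add: block_start_def take_Suc_conv_app_nth)

lemma block_of_eqI:
  assumes "block_start d k \<le> i" "i < block_start d (k + 1)"
  shows "block_of d i = k"
  unfolding block_of_def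
proof (rule Least_equality)
  show "i < block_start d (k + 1)" by fact
  fix y assume y: "i < block_start d (y + 1)"
  show "k \<le> y"
  proof (rule ccontr)
    assume "\<not> k \<le> y"
    then have "block_start d (y + 1) \<le> block_start d k" by (intro block_start_mono) simp
    then show False using y assms(1) by simp
  qed
qed

lemma block_of_props:
  assumes "i < sum_list d"
  shows "block_of d i < length d" "block_start d (block_of d i) \<le> i"
    "i < block_start d (block_of d i + 1)"
proof -
  have ex: "i < block_start d (length d - 1 + 1)" using assms
    by (cases d) (auto simp: block_start_def)
  show c: "i < block_start d (block_of d i + 1)"
    unfolding block_of_def by (rule LeastI[of "\<lambda>k. i < block_start d (k + 1)"]) (rule ex)
  have "block_of d i \<le> length d - 1"
    unfolding block_of_def by (rule Least_le) (rule ex)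
  moreover have "d \<noteq> []" using assms by auto
  ultimately show "block_of d i < length d" by (cases d) auto
  show "block_start d (block_of d i) \<le> i"
  proof (cases "block_of d i")
    case 0 then show ?thesis by (simp add: block_start_def)
  next
    case (Suc k)
    then have "\<not> i < block_start d (k + 1)"
      unfolding block_of_def by (metis lessI not_less_Least)
    then show ?thesis using Suc by simp
  qed
qed

lemma block_start_rev:
  assumes "rev d = d" "k \<le> length d"
  shows "block_start d (length d - k) = sum_list d - block_start d k"
proof -
  have "take (length d - k) (rev d) = rev (drop k d)"
    using assms(2) by (simp add: take_rev)
  then have "sum_list (take (length d - k) d) = sum_list (drop k d)"
    using assms(1) by (simp add: sum_list_rev)
  moreover have "sum_list d = sum_list (take k d) + sum_list (drop k d)"
    by (metis append_take_drop_id sum_list_append)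
  ultimately show ?thesis by (simp add: block_start_def)
qed

lemma block_of_reflect:
  assumes "rev d = d" "i < sum_list d"
  shows "block_of d (sum_list d - 1 - i) = length d - 1 - block_of d i"
proof -
  let ?k = "block_of d i"
  note p = block_of_props[OF assms(2)]
  have 1: "block_start d (length d - 1 - ?k) = sum_list d - block_start d (?k + 1)"
    using block_start_rev[OF assms(1), of "?k + 1"] p(1) by simp
  have 2: "block_start d (length d - 1 - ?k + 1) = sum_list d - block_start d ?k"
    using block_start_rev[OF assms(1), of ?k] p(1) by (simp add: Suc_diff_Suc)
  show ?thesis
    by (rule block_of_eqI; unfold 1 2) (use p assms(2) in linarith)+
qed

lemma central_D_entry_reflect:
  assumes "1 \<le> p" "p \<le> m" "1 \<le> q" "q \<le> m"
  shows "central_D_entry r m (m + 1 - q) (m + 1 - p) = - central_D_entry r m p q"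
proof -
  let ?K = "{1..m div 2}"
  have e: "m + 1 - x = m + 1 - 2 * k \<longleftrightarrow> x = 2 * k" "m + 1 - x = m + 2 - 2 * k \<longleftrightarrow> x = 2 * k - 1"
    "m + 1 - x = 2 * k - 1 \<longleftrightarrow> x = m + 2 - 2 * k" "m + 1 - x = 2 * k \<longleftrightarrow> x = m + 1 - 2 * k"
    if "k \<in> ?K" "1 \<le> x" "x \<le> m" for k x
  proof -
    have "1 \<le> k" "2 * k \<le> m" using that(1) by auto
    then show "m + 1 - x = m + 1 - 2 * k \<longleftrightarrow> x = 2 * k" using that(2,3) by arith
    show "m + 1 - x = m + 2 - 2 * k \<longleftrightarrow> x = 2 * k - 1"
      using that(2,3) \<open>1 \<le> k\<close> \<open>2 * k \<le> m\<close> by arith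
    show "m + 1 - x = 2 * k - 1 \<longleftrightarrow> x = m + 2 - 2 * k"
      using that(2,3) \<open>1 \<le> k\<close> \<open>2 * k \<le> m\<close> by arith
    show "m + 1 - x = 2 * k \<longleftrightarrow> x = m + 1 - 2 * k"
      using that(2,3) \<open>1 \<le> k\<close> \<open>2 * k \<le> m\<close> by arith
  qed
  have 1: "(\<exists>k\<in>?K. m + 1 - q = m + 1 - 2 * k \<and> m + 1 - p = 2 * k - 1) \<longleftrightarrow>
      (\<exists>k\<in>?K. p = m + 2 - 2 * k \<and> q = 2 * k)"
    by (rule bex_cong[OF refl]) (simp only: e assms conj_commute)
  have 2: "(\<exists>k\<in>?K. m + 1 - q = m + 2 - 2 * k \<and> m + 1 - p = 2 * k) \<longleftrightarrow>
      (\<exists>k\<in>?K. p = m + 1 - 2 * k \<and> q = 2 * k - 1)"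
    by (rule bex_cong[OF refl]) (simp only: e assms conj_commute)
  have 3: "(\<exists>k\<in>?K. m + 1 - q = 2 * k - 1 \<and> m + 1 - p = m + 1 - 2 * k) \<longleftrightarrow>
      (\<exists>k\<in>?K. p = 2 * k \<and> q = m + 2 - 2 * k)"
    by (rule bex_cong[OF refl]) (simp only: e assms conj_commute)
  have 4: "(\<exists>k\<in>?K. m + 1 - q = 2 * k \<and> m + 1 - p = m + 2 - 2 * k) \<longleftrightarrow>
      (\<exists>k\<in>?K. p = 2 * k - 1 \<and> q = m + 1 - 2 * k)"
    by (rule bex_cong[OF refl]) (simp only: e assms conj_commute)
  have ne: "2 * k - 1 \<noteq> 2 * l" if "k \<in> ?K" for k l :: nat
  proof -
    have "1 \<le> k" using that by auto
    then show ?thesis by presburger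
  qed
  have n1: "\<not> ((\<exists>k\<in>?K. p = m + 1 - 2 * k \<and> q = 2 * k - 1) \<and> (\<exists>k\<in>?K. p = m + 2 - 2 * k \<and> q = 2 * k))"
    using ne by metis
  have n2: "\<not> ((\<exists>k\<in>?K. p = 2 * k - 1 \<and> q = m + 1 - 2 * k) \<and> (\<exists>k\<in>?K. p = 2 * k \<and> q = m + 2 - 2 * k))"
    using ne by metis
  have swap: "(if Q then 1 else if P then - 1 else 0) = - (if P then 1 else if Q then - 1 else (0::complex))"
    if "\<not> (P \<and> Q)" for P Q using that by auto
  show ?thesis
    unfolding central_D_entry_def 1 2 3 4 swap[OF n1] swap[OF n2] by (cases "odd r") simp_all
qed

lemma J_pos_reflect:
  assumes "1 \<le> p" "p \<le> m" "1 \<le> q" "q \<le> m"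
  shows "(m + 1 - q, m + 1 - p) \<in> J_pos m 0 0 \<longleftrightarrow> (p, q) \<in> J_pos m 0 0"
proof -
  have "(x, y) \<in> J_pos m 0 0 \<longleftrightarrow> 1 \<le> x \<and> 1 \<le> y \<and> x + y = m + 1" for x y
    by (auto simp: J_pos_def image_iff intro!: bexI[of _ x])
  then show ?thesis using assms by auto
qed

lemma block_entry_central:
  assumes "rev d = d" "i < sum_list d" "j < sum_list d"
    "block_of d j = block_of d i + 1" "2 * (block_of d i + 1) = length d" "t \<noteq> Type_A"
  shows "block_entry t d (sum_list d - 1 - j) (sum_list d - 1 - i) =
    (if t = Type_C then 1 else - 1) * block_entry t d i j"
proof -
  let ?k = "block_of d i" and ?N = "sum_list d"
  define m where "m = blk d (?k + 1)"
  define s where "s = block_start d ?k"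
  note pi = block_of_props[OF assms(2)] and pj = block_of_props[OF assms(3)]
  have m: "d ! ?k = m" by (simp add: m_def blk_def)
  have sm: "block_start d (?k + 1) = s + m"
    using block_start_Suc[of ?k d] pi(1) m by (simp add: s_def)
  have "length d - (?k + 1) = ?k + 1" using assms(5) by simp
  then have "block_start d (?k + 1) = ?N - block_start d (?k + 1)"
    using block_start_rev[OF assms(1), of "?k + 1"] assms(5) by simp
  then have N: "?N = 2 * (s + m)" using sm assms(2) pj(2) assms(3,4) by simp
  have ri: "block_of d (?N - 1 - j) = ?k" "block_of d (?N - 1 - i) = ?k + 1"
    using block_of_reflect[OF assms(1,2)] block_of_reflect[OF assms(1,3)] assms(4,5) by simp_all
  define p where "p = i - s + 1"
  define q where "q = j - (s + m) + 1"
  have i: "s \<le> i" "i < s + m" using pi sm by (simp_all add: s_def)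
  have j: "s + m \<le> j" "j < 2 * (s + m)" using pj assms(3,4) sm N by simp_all
  have ik: "block_start d (block_of d j) = s + m" using sm assms(4) by simp
  have "j < s + m + m"
    using pi pj ri block_of_props[of "?N - 1 - j" d] assms(2,3) N i j by (simp add: s_def)
  then have pq: "1 \<le> p" "p \<le> m" "1 \<le> q" "q \<le> m" using i j by (simp_all add: p_def q_def)
  have l: "block_entry t d i j = rect_entry t d (?k + 1) p q"
    by (simp add: block_entry_def ik p_def q_def flip: s_def)
  have "?N - 1 - j - s + 1 = m + 1 - q" "?N - 1 - i - (s + m) + 1 = m + 1 - p"
    using i j \<open>j < s + m + m\<close> by (simp_all add: p_def q_def N)
  then have r: "block_entry t d (?N - 1 - j) (?N - 1 - i) =
      rect_entry t d (?k + 1) (m + 1 - q) (m + 1 - p)"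
    unfolding block_entry_def ri sm by (simp flip: s_def)
  show ?thesis
    unfolding l r rect_entry_def m_def[symmetric]
    using assms(5,6) central_D_entry_reflect[OF pq] J_pos_reflect[OF pq] by simp
qed

lemma X_R_reflect:
  assumes "block_sequence t n d" "t \<noteq> Type_A" "i < mat_size t n" "j < mat_size t n"
  shows "X_R t n d $$ (mat_size t n - 1 - j, mat_size t n - 1 - i) =
    reflection_sign t n i j * X_R t n d $$ (i, j)"
proof -
  define N where "N = mat_size t n"
  have N: "sum_list d = N" and rev: "rev d = d"
    using assms by (auto simp: block_sequence_def N_def)
  have ij: "i < N" "j < N" using assms by (auto simp: N_def)
  let ?i = "N - 1 - j" and ?j = "N - 1 - i"
  have X: "X_R t n d $$ (x, y) = (if block_of d y \<noteq> block_of d x + 1 then 0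
     else if 2 * (block_of d x + 1) \<le> length d then block_entry t d x y
     else reflection_sign t n x y * block_entry t d (N - 1 - y) (N - 1 - x))"
    if "x < N" "y < N" for x y
    using that assms(2) by (simp add: X_R_def Let_def flip: N_def)
  have b: "block_of d ?i = length d - 1 - block_of d j" "block_of d ?j = length d - 1 - block_of d i"
    using block_of_reflect[OF rev] ij N by auto
  have l: "block_of d i < length d" "block_of d j < length d"
    using block_of_props(1) ij N by auto
  have NN: "N - 1 - ?j = i" "N - 1 - ?i = j" using ij by auto
  have sg: "reflection_sign t n ?i ?j = reflection_sign t n i j"
    using ij by (cases t) (auto simp: reflection_sign_def N_def)
  have sg2: "reflection_sign t n i j * (reflection_sign t n i j * x) = x" for x
    by (simp add: reflection_sign_def)
  show ?thesis
  proof (cases "block_of d j = block_of d i + 1")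
    case False
    then have "block_of d ?j \<noteq> block_of d ?i + 1" using b l by auto
    then show ?thesis using False X ij by (simp flip: N_def)
  next
    case True
    have b': "block_of d ?j = block_of d ?i + 1" using b l True by auto
    have k: "block_of d ?i + 1 + (block_of d i + 1) = length d"
      unfolding b(1) using l True by simp
    consider "2 * (block_of d i + 1) < length d" | "2 * (block_of d i + 1) = length d"
      | "2 * (block_of d i + 1) > length d" by linarith
    then show ?thesis
    proof cases
      case 1
      then have "\<not> 2 * (block_of d ?i + 1) \<le> length d" using k by simp
      then show ?thesis using X[of i j] X[of ?i ?j] ij b' True 1 NN sg by (simp flip: N_def)
    next
      case 2
      then have le2: "2 * (block_of d ?i + 1) \<le> length d" using k by simp
      have e: "block_entry t d ?i ?j = (if t = Type_C then 1 else - 1) * block_entry t d i j"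
        using block_entry_central[OF rev _ _ True 2 assms(2)] ij N by simp
      have "reflection_sign t n i j = 1" if "t = Type_C"
      proof -
        have NC: "N = 2 * n" using that by (simp add: N_def)
        have "block_start d (block_of d i + 1) = n"
        proof -
          have "length d - (block_of d i + 1) = block_of d i + 1" using 2 by simp
          moreover have "block_start d (block_of d i + 1) \<le> N"
            using block_start_mono[of "block_of d i + 1" "length d" d] l(1) N
            by (simp add: block_start_def)
          ultimately show ?thesis
            using block_start_rev[OF rev, of "block_of d i + 1"] l(1) N NC by simp
        qed
        then have "i < n" "\<not> j < n"
          using block_of_props[of i d] block_of_props[of j d] ij N True by auto
        then show ?thesis using that by (simp add: reflection_sign_def)
      qed
      moreover have "reflection_sign t n i j = - 1" if "t \<noteq> Type_C"
        using that by (simp add: reflection_sign_def)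
      ultimately show ?thesis
        using X[of i j] X[of ?i ?j] ij b' True 2 le2 e by (auto simp flip: N_def)
    next
      case 3
      then have "2 * (block_of d ?i + 1) \<le> length d" using k by simp
      then show ?thesis using X[of i j] X[of ?i ?j] ij b' True 3 sg2 by (simp flip: N_def)
    qed
  qed
qed

lemma sp_algI:
  assumes A: "A \<in> carrier_mat (2 * n) (2 * n)"
    and refl: "\<And>i j. i < 2 * n \<Longrightarrow> j < 2 * n \<Longrightarrow>
      A $$ (2 * n - 1 - j, 2 * n - 1 - i) = reflection_sign Type_C n i j * A $$ (i, j)"
  shows "A \<in> sp_alg n"
proof -
  let ?N = "2 * n"
  let ?W = "symplectic_form n"
  have W: "?W \<in> carrier_mat ?N ?N"
    unfolding symplectic_form_def skew_unit_def by (simp add: mult_2)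
  have Wij: "?W $$ (i, j) = (if j = ?N - 1 - i then (if i < n then 1 else - 1) else 0)"
    if "i < ?N" "j < ?N" for i j
    using that unfolding symplectic_form_def skew_unit_def by auto
  have 1: "(transpose_mat A * ?W) $$ (i, j) = A $$ (?N - 1 - j, i) * (if j < n then - 1 else 1)"
    if ij: "i < ?N" "j < ?N" for i j
  proof -
    have "(transpose_mat A * ?W) $$ (i, j) = (\<Sum>k<?N. A $$ (k, i) * ?W $$ (k, j))"
      using A W ij by (simp add: scalar_prod_def atLeast0LessThan)
    also have "\<dots> = (\<Sum>k<?N. if k = ?N - 1 - j then A $$ (k, i) * (if k < n then 1 else - 1) else 0)"
      using ij by (intro sum.cong refl) (auto simp: Wij)
    also have "\<dots> = A $$ (?N - 1 - j, i) * (if j < n then - 1 else 1)"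
      using ij by (subst sum.delta) auto
    finally show ?thesis .
  qed
  have 2: "(?W * A) $$ (i, j) = (if i < n then 1 else - 1) * A $$ (?N - 1 - i, j)"
    if ij: "i < ?N" "j < ?N" for i j
  proof -
    have "(?W * A) $$ (i, j) = (\<Sum>k<?N. ?W $$ (i, k) * A $$ (k, j))"
      using A W ij by (simp add: scalar_prod_def atLeast0LessThan)
    also have "\<dots> = (\<Sum>k<?N. if k = ?N - 1 - i then (if i < n then 1 else - 1) * A $$ (k, j) else 0)"
      using ij by (intro sum.cong refl) (auto simp: Wij)
    also have "\<dots> = (if i < n then 1 else - 1) * A $$ (?N - 1 - i, j)"
      using ij by (subst sum.delta) auto
    finally show ?thesis .
  qed
  have "transpose_mat A * ?W + ?W * A = 0\<^sub>m ?N ?N"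
  proof (rule eq_matI)
    fix i j assume "i < dim_row (0\<^sub>m ?N ?N :: complex mat)" "j < dim_col (0\<^sub>m ?N ?N :: complex mat)"
    then have ij: "i < ?N" "j < ?N" by simp_all
    have r: "A $$ (?N - 1 - j, i) =
        reflection_sign Type_C n (?N - 1 - i) j * A $$ (?N - 1 - i, j)"
      using refl[of "?N - 1 - i" j] ij by simp
    have "(transpose_mat A * ?W + ?W * A) $$ (i, j) =
        (transpose_mat A * ?W) $$ (i, j) + (?W * A) $$ (i, j)"
      using A W ij by simp
    also have "\<dots> = 0"
      unfolding 1[OF ij] 2[OF ij] r using ij by (auto simp: reflection_sign_def)
    finally show "(transpose_mat A * ?W + ?W * A) $$ (i, j) = 0\<^sub>m ?N ?N $$ (i, j)"
      using ij by simp
  qed (use A W in auto)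
  then show ?thesis using A by (simp add: sp_alg_def)
qed

lemma X_R_in_graded_piece:
  assumes "block_sequence t n d"
  shows "X_R t n d \<in> graded_piece t n d 1"
proof -
  let ?N = "mat_size t n"
  have car: "X_R t n d \<in> carrier_mat ?N ?N" by (simp add: X_R_def Let_def)
  have supp: "int (block_of d j) - int (block_of d i) = 1"
    if "i < ?N" "j < ?N" "X_R t n d $$ (i, j) \<noteq> 0" for i j
    using that by (auto simp: X_R_def Let_def split: if_splits)
  have diag: "X_R t n d $$ (i, i) = 0" if "i < ?N" for i
    using supp[OF that that] by fastforce
  have "X_R t n d \<in> lie_alg t n"
  proof (cases t)
    case Type_A
    then show ?thesis using car diag by (simp add: sl_alg_def)
  next
    case Type_B
    then show ?thesis using car X_R_reflect[OF assms]
      by (simp add: so_alg_def reflection_sign_def)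
  next
    case Type_C
    then show ?thesis using car X_R_reflect[OF assms] by (auto intro!: sp_algI)
  next
    case Type_D
    then show ?thesis using car X_R_reflect[OF assms]
      by (simp add: so_alg_def reflection_sign_def)
  qed
  then show ?thesis using supp by (auto simp: graded_piece_def)
qed


subsection \<open>The roots involved in \<open>X\<^sub>R\<close>\<close>

definition S_1 :: "lie_type \<Rightarrow> nat \<Rightarrow> nat list \<Rightarrow> (complex mat \<Rightarrow> complex) set" where
  "S_1 t n d = {\<alpha> \<in> roots t n. has_root_component t n (X_R t n d) \<alpha>}"


section \<open>The form (*)\<close>

definition unimodal :: "nat list \<Rightarrow> bool" where
  "unimodal d \<longleftrightarrow> (\<exists>k. sorted_wrt (\<le>) (take k d) \<and> sorted_wrt (\<ge>) (drop k d))"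

definition form_star :: "nat list \<Rightarrow> bool" where
  "form_star d \<longleftrightarrow> odd (length d) \<and> (let r = length d div 2 in
     (unimodal d \<and> (\<exists>i. 1 \<le> i \<and> i < r \<and> odd (blk d i) \<and> even (blk d (i + 1)))) \<or>
     (\<exists>l. 1 \<le> l \<and> l \<le> r \<and> blk d l > blk d (l + 1) \<and>
        (\<exists>i. 1 \<le> i \<and> i < l \<and> odd (blk d i) \<and> even (blk d (i + 1)) \<and>
           (i = l - 1 \<longrightarrow> blk d (l - 1) < blk d (l + 1)))) \<or>
     (\<exists>l. 1 \<le> l \<and> l \<le> r \<and> blk d l > blk d (l + 1) \<and> odd (blk d l)))"

end

theory Submission
  imports Defs
begin

text \<open>A root of \<open>S\<^sub>1\<close> has the form \<open>\<epsilon>\<^sub>i - \<epsilon>\<^sub>j\<close> on the Cartan subalgebra, for a nonzero entry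
  \<open>(i, j)\<close> of \<open>X\<^sub>R\<close>, and outside type A the reflection in the skew-diagonal does not change it. So
  the roots are counted by the nonzero entries of the rectangles in the upper left half. The \<open>i\<close>-th
  rectangle has at most \<open>a\<^sub>i\<close> of these, except that in the orthogonal case (B) there may be one more
  if \<open>a\<^sub>i\<close> is odd and \<open>a\<^bsub>i+1\<^esub>\<close> is even. Along an increasing part of the sequence such an excess is
  compensated by the growth of \<open>\<lfloor>a\<^sub>i / 2\<rfloor>\<close>, and the rank contains a summand \<open>\<lfloor>a\<^bsub>r+1\<^esub> / 2\<rfloor>\<close> from the
  central block; at a descent, the failure of (*) leaves room for only one excess before it.\<close>

section \<open>Roots and matrix entries\<close>

text \<open>Restricted to the Cartan subalgebra, so that it can be equal as a function to an
  extensional element of \<open>cartan_dual\<close>.\<close>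

definition entry_root :: "lie_type \<Rightarrow> nat \<Rightarrow> nat \<times> nat \<Rightarrow> complex mat \<Rightarrow> complex" where
  "entry_root t n = (\<lambda>(i, j). \<lambda>H\<in>cartan t n. H $$ (i, i) - H $$ (j, j))"

lemma lie_alg_carrier: "A \<in> lie_alg t n \<Longrightarrow> A \<in> carrier_mat (mat_size t n) (mat_size t n)"
  by (cases t) (auto simp: sl_alg_def so_alg_def sp_alg_def)

lemma bracket_diagonal:
  assumes H: "H \<in> carrier_mat N N" "diagonal_mat H" and Y: "Y \<in> carrier_mat N N"
    and ij: "i < N" "j < N"
  shows "bracket H Y $$ (i, j) = (H $$ (i, i) - H $$ (j, j)) * Y $$ (i, j)"
proof -
  have off: "H $$ (k, l) = 0" if "k < N" "l < N" "k \<noteq> l" for k l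
    using H that by (auto simp: diagonal_mat_def)
  have "(H * Y) $$ (i, j) = (\<Sum>k<N. H $$ (i, k) * Y $$ (k, j))"
    using H Y ij by (simp add: scalar_prod_def atLeast0LessThan)
  also have "\<dots> = (\<Sum>k<N. if k = i then H $$ (i, i) * Y $$ (i, j) else 0)"
    using ij off by (intro sum.cong) auto
  also have "\<dots> = H $$ (i, i) * Y $$ (i, j)"
    using ij by simp
  finally have 1: "(H * Y) $$ (i, j) = H $$ (i, i) * Y $$ (i, j)" .
  have "(Y * H) $$ (i, j) = (\<Sum>k<N. Y $$ (i, k) * H $$ (k, j))"
    using H Y ij by (simp add: scalar_prod_def atLeast0LessThan)
  also have "\<dots> = (\<Sum>k<N. if k = j then Y $$ (i, j) * H $$ (j, j) else 0)"
    using ij off by (intro sum.cong) auto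
  also have "\<dots> = Y $$ (i, j) * H $$ (j, j)"
    using ij by simp
  finally have 2: "(Y * H) $$ (i, j) = Y $$ (i, j) * H $$ (j, j)" .
  have "bracket H Y $$ (i, j) = (H * Y) $$ (i, j) - (Y * H) $$ (i, j)"
    using H Y ij by (simp add: bracket_def)
  then show ?thesis unfolding 1 2 by (simp add: algebra_simps)
qed

text \<open>A diagonal \<open>H\<close> acts on each matrix entry by a scalar, so a single nonzero
  entry of a root vector already fixes the eigenvalue \<open>\<beta> H\<close>, and hence the
  root.\<close>

lemma root_eq_entry_root:
  assumes r: "\<beta> \<in> roots t n" and Y: "Y \<in> root_space t n \<beta>"
    and ij: "i < mat_size t n" "j < mat_size t n" and nz: "Y $$ (i, j) \<noteq> 0"
  shows "\<beta> = entry_root t n (i, j)"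
proof
  fix H
  show "\<beta> H = entry_root t n (i, j) H"
  proof (cases "H \<in> cartan t n")
    case False
    then show ?thesis using r
      by (auto simp: entry_root_def roots_def cartan_dual_def extensional_def)
  next
    case True
    let ?N = "mat_size t n"
    have H: "H \<in> carrier_mat ?N ?N" "diagonal_mat H"
      using True lie_alg_carrier by (auto simp: cartan_def)
    have Yc: "Y \<in> carrier_mat ?N ?N"
      using Y lie_alg_carrier by (auto simp: root_space_def)
    have "bracket H Y = \<beta> H \<cdot>\<^sub>m Y" using Y True by (simp add: root_space_def)
    then have "(H $$ (i, i) - H $$ (j, j)) * Y $$ (i, j) = \<beta> H * Y $$ (i, j)"
      using bracket_diagonal[OF H Yc ij] Yc ij by auto
    then show ?thesis using nz True by (simp add: entry_root_def)
  qed
qed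

text \<open>No cancellation can hide the component \<open>Y \<alpha>\<close>: at a position where it
  is nonzero, all other summands and the Cartan part \<open>Z\<close> vanish.\<close>

lemma root_component_entry:
  assumes "has_root_component t n X \<alpha>"
  obtains i j where "i < mat_size t n" "j < mat_size t n" "X $$ (i, j) \<noteq> 0"
    "\<alpha> = entry_root t n (i, j)"
proof -
  let ?N = "mat_size t n"
  obtain Z F Y where Z: "Z \<in> cartan t n" and F: "finite F" "F \<subseteq> roots t n"
    and Y_all: "\<forall>\<beta>\<in>F. Y \<beta> \<in> root_space t n \<beta>"
    and X: "\<forall>i<?N. \<forall>j<?N. X $$ (i, j) = Z $$ (i, j) + (\<Sum>\<beta>\<in>F. Y \<beta> $$ (i, j))"
    and \<alpha>: "\<alpha> \<in> F" "Y \<alpha> \<noteq> 0\<^sub>m ?N ?N"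
    using assms unfolding has_root_component_def Let_def by (elim exE conjE)
  note Y = bspec[OF Y_all]
  have "Y \<alpha> \<in> carrier_mat ?N ?N"
    using Y \<alpha>(1) lie_alg_carrier by (auto simp: root_space_def)
  then obtain i j where ij: "i < ?N" "j < ?N" and nz: "Y \<alpha> $$ (i, j) \<noteq> 0"
    using \<alpha>(2) by (metis carrier_matD eq_matI index_zero_mat)
  have \<alpha>_eq: "\<alpha> = entry_root t n (i, j)"
    using root_eq_entry_root[OF _ Y ij nz] F \<alpha>(1) by blast
  \<comment> \<open>Two summands that are nonzero at the same position belong to the same
    root.\<close>
  have other: "Y \<beta> $$ (i, j) = 0" if "\<beta> \<in> F" "\<beta> \<noteq> \<alpha>" for \<beta>
    using root_eq_entry_root[OF _ Y ij] F that \<alpha>_eq by blast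
  \<comment> \<open>A root is nonzero, while \<open>entry_root\<close> vanishes at diagonal
    positions; hence the position is off the diagonal and \<open>Z\<close> contributes 0.\<close>
  obtain H where "H \<in> cartan t n" "\<alpha> H \<noteq> 0" using F \<alpha>(1) by (auto simp: roots_def)
  then have "i \<noteq> j" unfolding \<alpha>_eq entry_root_def by auto
  then have "Z $$ (i, j) = 0"
    using Z ij lie_alg_carrier by (fastforce simp: cartan_def diagonal_mat_def)
  moreover have "(\<Sum>\<beta>\<in>F. Y \<beta> $$ (i, j)) = Y \<alpha> $$ (i, j)"
    using F(1) \<alpha>(1) other by (subst sum.remove[of _ \<alpha>]) auto
  ultimately have "X $$ (i, j) \<noteq> 0" using X ij nz by simp
  then show ?thesis using that ij \<alpha>_eq by blast
qed

section \<open>Invariance of the roots under reflection in the skew-diagonal\<close>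

lemma sp_diagonal_reflect:
  assumes H: "H \<in> sp_alg n" "diagonal_mat H" and i: "i < n"
  shows "H $$ (2 * n - 1 - i, 2 * n - 1 - i) = - H $$ (i, i)"
proof -
  let ?N = "2 * n" and ?W = "symplectic_form n" and ?j = "2 * n - 1 - i"
  have Hc: "H \<in> carrier_mat ?N ?N" and eq: "transpose_mat H * ?W + ?W * H = 0\<^sub>m ?N ?N"
    using H by (auto simp: sp_alg_def)
  have W: "?W \<in> carrier_mat ?N ?N"
    unfolding symplectic_form_def skew_unit_def by (simp add: mult_2)
  \<comment> \<open>In entry \<open>(i, ?j)\<close> of the defining equation only this value of the
    form survives, which leaves \<open>H $$ (i, i) + H $$ (?j, ?j) = 0\<close>.\<close>
  have W1: "?W $$ (i, ?j) = 1"
    using i unfolding symplectic_form_def skew_unit_def by auto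
  have ij: "i < ?N" "?j < ?N" using i by auto
  have off: "H $$ (k, l) = 0" if "k < ?N" "l < ?N" "k \<noteq> l" for k l
    using H Hc that by (auto simp: diagonal_mat_def)
  have "(transpose_mat H * ?W) $$ (i, ?j) = (\<Sum>k<?N. H $$ (k, i) * ?W $$ (k, ?j))"
    using Hc W ij by (simp add: scalar_prod_def atLeast0LessThan)
  also have "\<dots> = (\<Sum>k<?N. if k = i then H $$ (i, i) else 0)"
    using ij off W1 by (intro sum.cong) auto
  finally have 1: "(transpose_mat H * ?W) $$ (i, ?j) = H $$ (i, i)" using ij by simp
  have "(?W * H) $$ (i, ?j) = (\<Sum>k<?N. ?W $$ (i, k) * H $$ (k, ?j))"
    using Hc W ij by (simp add: scalar_prod_def atLeast0LessThan)
  also have "\<dots> = (\<Sum>k<?N. if k = ?j then H $$ (?j, ?j) else 0)"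
    using ij off W1 by (intro sum.cong) auto
  finally have 2: "(?W * H) $$ (i, ?j) = H $$ (?j, ?j)" using ij by simp
  have "(transpose_mat H * ?W + ?W * H) $$ (i, ?j) = 0" unfolding eq using ij by simp
  then have "(transpose_mat H * ?W) $$ (i, ?j) + (?W * H) $$ (i, ?j) = 0"
    using Hc W ij by simp
  then show ?thesis unfolding 1 2 by (simp add: add_eq_0_iff)
qed

lemma cartan_diagonal_reflect:
  assumes "t \<noteq> Type_A" "H \<in> cartan t n" "i < mat_size t n"
  shows "H $$ (mat_size t n - 1 - i, mat_size t n - 1 - i) = - H $$ (i, i)"
proof (cases "t = Type_C")
  case True
  then have H: "H \<in> sp_alg n" "diagonal_mat H" using assms by (auto simp: cartan_def)
  show ?thesis
  proof (cases "i < n")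
    case False
    then show ?thesis
      using sp_diagonal_reflect[OF H, of "2 * n - 1 - i"] assms(3) True by simp
  qed (use sp_diagonal_reflect[OF H] True in simp)
next
  case False
  then show ?thesis using assms by (cases t) (auto simp: cartan_def so_alg_def)
qed

lemma entry_root_reflect:
  assumes "t \<noteq> Type_A" "i < mat_size t n" "j < mat_size t n"
  shows "entry_root t n (mat_size t n - 1 - j, mat_size t n - 1 - i) = entry_root t n (i, j)"
  unfolding entry_root_def using cartan_diagonal_reflect[OF assms(1)] assms(2,3)
  by (auto simp: restrict_def)

section \<open>Counting roots by the entries of the rectangles\<close>

text \<open>The range conditions matter: a position set such as \<open>rect_BD\<close> can stick out
  of the rectangle when the next block is short.\<close>

definition rect_supp :: "lie_type \<Rightarrow> nat list \<Rightarrow> nat \<Rightarrow> (nat \<times> nat) set" where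
  "rect_supp t d k = {(p, q). p \<in> {1..blk d k} \<and> q \<in> {1..blk d (k + 1)} \<and> rect_entry t d k p q \<noteq> 0}"

text \<open>Outside type A only the rectangles with prescribed entries count; for an even number of
  blocks the last of them is the central square.\<close>

definition num_rects :: "lie_type \<Rightarrow> nat list \<Rightarrow> nat" where
  "num_rects t d = (if t = Type_A then length d - 1 else length d div 2)"

lemma finite_rect_supp: "finite (rect_supp t d k)"
  by (rule finite_subset[of _ "{1..blk d k} \<times> {1..blk d (k + 1)}"]) (auto simp: rect_supp_def)

text \<open>Each root comes from a nonzero entry of \<open>X_R\<close>, which is reflected first if
  it lies in the lower right half. The \<open>- 1\<close> converts 1-based positions in a rectangle
  to 0-based matrix indices.\<close>

lemma S_1_subset:
  assumes "block_sequence t n d"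
  shows "S_1 t n d \<subseteq> entry_root t n ` (\<Union>k<num_rects t d.
    (\<lambda>(p, q). (block_start d k + p - 1, block_start d (k + 1) + q - 1)) ` rect_supp t d (k + 1))"
    (is "_ \<subseteq> entry_root t n ` ?U")
proof
  fix \<alpha> assume "\<alpha> \<in> S_1 t n d"
  then have "has_root_component t n (X_R t n d) \<alpha>" by (simp add: S_1_def)
  then obtain i j where ij: "i < mat_size t n" "j < mat_size t n" and nz: "X_R t n d $$ (i, j) \<noteq> 0"
    and \<alpha>: "\<alpha> = entry_root t n (i, j)"
    by (rule root_component_entry)
  define N where "N = mat_size t n"
  have N: "sum_list d = N" using assms by (simp add: block_sequence_def N_def)
  have ijN: "i < N" "j < N" using ij by (simp_all add: N_def)
  \<comment> \<open>Stated for arbitrary positions, because it is applied both to the given entry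
    and to its mirror image.\<close>
  have in_U: "(i, j) \<in> ?U"
    if ij: "i < N" "j < N" and b: "block_of d j = block_of d i + 1"
      and h: "t = Type_A \<or> 2 * (block_of d i + 1) \<le> length d" and e: "block_entry t d i j \<noteq> 0" for i j
  proof -
    let ?k = "block_of d i"
    have pi: "block_start d ?k \<le> i" "i < block_start d (?k + 1)"
      using block_of_props[of i d] ij N by auto
    have pj: "?k + 1 < length d" "block_start d (?k + 1) \<le> j" "j < block_start d (?k + 2)"
      using block_of_props[of j d] ij N b by auto
    have s: "block_start d (?k + 1) = block_start d ?k + blk d (?k + 1)"
      "block_start d (?k + 2) = block_start d (?k + 1) + blk d (?k + 2)"
      using block_start_Suc[of ?k d] block_start_Suc[of "?k + 1" d] pj(1) by (simp_all add: blk_def)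
    define p q where "p = i - block_start d ?k + 1" and "q = j - block_start d (?k + 1) + 1"
    have "(p, q) \<in> rect_supp t d (?k + 1)"
      using pi pj s e b by (auto simp: rect_supp_def block_entry_def p_def q_def)
    moreover have "(i, j) = (block_start d ?k + p - 1, block_start d (?k + 1) + q - 1)"
      using pi pj by (simp add: p_def q_def)
    moreover have "?k < num_rects t d" using h pj(1) by (auto simp: num_rects_def)
    ultimately show ?thesis by force
  qed
  have X: "X_R t n d $$ (i, j) = (if block_of d j \<noteq> block_of d i + 1 then 0
     else if t = Type_A \<or> 2 * (block_of d i + 1) \<le> length d then block_entry t d i j
     else reflection_sign t n i j * block_entry t d (N - 1 - j) (N - 1 - i))"
    using ijN by (simp add: X_R_def Let_def flip: N_def)
  have b: "block_of d j = block_of d i + 1" using nz X by (auto split: if_splits)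
  show "\<alpha> \<in> entry_root t n ` ?U"
  proof (cases "t = Type_A \<or> 2 * (block_of d i + 1) \<le> length d")
    case True
    then have "(i, j) \<in> ?U" using in_U[OF ijN b] nz X b by simp
    then show ?thesis unfolding \<alpha> by (rule imageI)
  next
    case False
    then have rev: "rev d = d" using assms by (auto simp: block_sequence_def)
    have ri: "block_of d (N - 1 - j) = length d - 1 - block_of d j"
      "block_of d (N - 1 - i) = length d - 1 - block_of d i"
      using block_of_reflect[OF rev] ijN N by auto
    have "block_of d j < length d" using block_of_props(1) ijN N by auto
    then have "block_of d (N - 1 - i) = block_of d (N - 1 - j) + 1"
      "2 * (block_of d (N - 1 - j) + 1) \<le> length d"
      using ri b False by auto
    then have mem: "(N - 1 - j, N - 1 - i) \<in> ?U"
      using in_U[of "N - 1 - j" "N - 1 - i"] ijN nz X b False by auto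
    have "\<alpha> = entry_root t n (N - 1 - j, N - 1 - i)"
      using entry_root_reflect[OF _ ij] False by (simp add: \<alpha> N_def)
    then show ?thesis using mem by (rule image_eqI)
  qed
qed

lemma S_1_card:
  assumes "block_sequence t n d"
  shows "finite (S_1 t n d)"
    and "card (S_1 t n d) \<le> (\<Sum>k<num_rects t d. card (rect_supp t d (k + 1)))"
proof -
  define g where "g k = (\<lambda>(p, q). (block_start d k + p - 1, block_start d (k + 1) + q - 1)) `
    rect_supp t d (k + 1)" for k
  let ?U = "\<Union>k<num_rects t d. g k"
  have sub: "S_1 t n d \<subseteq> entry_root t n ` ?U"
    using S_1_subset[OF assms] by (simp add: g_def)
  have fin: "finite ?U" by (auto simp: g_def finite_rect_supp)
  then show "finite (S_1 t n d)" using sub by (blast intro: finite_subset)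
  have "card (S_1 t n d) \<le> card ?U"
    using card_mono[OF _ sub] card_image_le[OF fin, of "entry_root t n"] fin by fastforce
  also have "\<dots> \<le> (\<Sum>k<num_rects t d. card (g k))" by (rule card_UN_le) simp
  also have "\<dots> \<le> (\<Sum>k<num_rects t d. card (rect_supp t d (k + 1)))"
    unfolding g_def by (intro sum_mono card_image_le finite_rect_supp)
  finally show "card (S_1 t n d) \<le> (\<Sum>k<num_rects t d. card (rect_supp t d (k + 1)))" .
qed

section \<open>The size of the rectangles\<close>

lemma finite_J_pos [simp]: "finite (J_pos m s t)"
  by (simp add: J_pos_def)

lemma finite_corners [simp]: "finite (upper_right a b m)" "finite (lower_left a b m)"
  by (simp_all add: upper_right_def lower_left_def)

lemma card_J_pos_le: "card (J_pos m s t) \<le> m"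
  unfolding J_pos_def using card_image_le[of "{1..m}"] by fastforce

lemma card_corners_le: "card (upper_right a b m) \<le> m" "card (lower_left a b m) \<le> m"
  unfolding upper_right_def lower_left_def by (rule card_J_pos_le)+

text \<open>A skew-diagonal meets each column at most once, so the width bounds the count even when
  the skew-diagonal is longer.\<close>

lemma card_J_pos_columns_le: "card (J_pos m s t \<inter> {(p, q). q \<in> {1..b}}) \<le> b"
proof -
  let ?S = "J_pos m s t \<inter> {(p, q). q \<in> {1..b}}"
  have "inj_on snd ?S" by (auto simp: inj_on_def J_pos_def)
  then have "card ?S = card (snd ` ?S)" by (simp add: card_image)
  also have "\<dots> \<le> card {1..b}" by (intro card_mono) auto
  finally show ?thesis by simp
qed

lemma card_corners_Un_le: "card (upper_right a b m \<union> lower_left a b m') \<le> m + m'"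
  by (rule order_trans[OF card_Un_le add_mono]) (rule card_corners_le)+

lemma card_corners_columns_le:
  "card ((upper_right a b m \<union> lower_left a b m') \<inter> {(p, q). q \<in> {1..c}}) \<le> c + c"
  unfolding Int_Un_distrib2 upper_right_def lower_left_def
  by (rule order_trans[OF card_Un_le add_mono]) (rule card_J_pos_columns_le)+

lemma finite_rect_A [simp]: "finite (rect_A i a b)"
  by (simp add: rect_A_def)

lemma finite_rect_halves [simp]: "finite (rect_halves i a b)"
  by (simp add: rect_halves_def)

lemma card_rect_A_le: "card (rect_A i a b) \<le> a"
  using card_corners_le[of a b a] card_corners_le[of a b b] by (auto simp: rect_A_def)

lemma card_rect_halves_le: "card (rect_halves i a b) \<le> a"
proof -
  have "a div 2 + (a + 1) div 2 = a" by presburger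
  then show ?thesis
    using card_corners_Un_le[of a b "a div 2" "(a + 1) div 2"]
      card_corners_Un_le[of a b "(a + 1) div 2" "a div 2"]
    by (auto simp: rect_halves_def)
qed

lemma finite_rect_C [simp]: "finite (rect_C d i)"
  by (simp add: rect_C_def Let_def)

lemma card_rect_C_le: "card (rect_C d i) \<le> blk d i"
  using card_corners_le card_rect_halves_le by (auto simp: rect_C_def Let_def)

lemma finite_rect_BD [simp]: "finite (rect_BD t d i)"
  by (simp add: rect_BD_def Let_def)

text \<open>An excess arises only from two skew-diagonals of length \<lceil>a/2\<rceil> with
  \<open>a\<close> odd; this shape requires neighbouring blocks of different parity, so the next
  length is even.\<close>

lemma card_rect_BD_le:
  "card (rect_BD t d i) \<le> blk d i + of_bool (odd (length d) \<and> odd (blk d i) \<and> even (blk d (i + 1)))"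
proof -
  let ?a = "blk d i" and ?b = "blk d (i + 1)"
  let ?c = "(?a + 1) div 2"
  have 1: "card (upper_right ?a ?b (?c - 1) \<union> lower_left ?a ?b ?c) \<le> ?a"
    "card (upper_right ?a ?b ?c \<union> lower_left ?a ?b (?c - 1)) \<le> ?a"
    by (rule order_trans[OF card_corners_Un_le], presburger)+
  have 2: "card (upper_right ?a ?b ?c \<union> lower_left ?a ?b ?c) \<le> ?a + of_bool (odd ?a)"
    by (rule order_trans[OF card_corners_Un_le]) (cases "odd ?a"; simp; presburger)
  \<comment> \<open>The sets are abstracted to variables, so that only the parities of
    \<open>?a\<close> and \<open>?b\<close> remain to be distinguished.\<close>
  have split: "card (if P then S else if E then S' else if even ?a = even ?b then S1
      else if F then (if odd i then S2 else S3) else S4) \<le> ?a + of_bool (\<not> P \<and> odd ?a \<and> even ?b)"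
    if "card S \<le> ?a" "card S' \<le> ?a" "card S1 \<le> ?a" "card S2 \<le> ?a" "card S3 \<le> ?a"
      "card S4 \<le> ?a + of_bool (odd ?a)"
    for P E F and S S' S1 S2 S3 S4 :: "(nat \<times> nat) set"
    using that by (cases "odd ?a"; cases "odd ?b") auto
  show ?thesis
    unfolding rect_BD_def Let_def
    by (rule split[OF card_rect_A_le card_rect_halves_le card_J_pos_le 1 2])
qed

text \<open>Needed for a descent to a block of length 1, where \<lfloor>1/2\<rfloor> = 0 gives no
  room for an earlier excess. For height 2 the skew-diagonals have lengths 0 and 1; for greater
  height the single column holds at most two ones.\<close>

lemma card_rect_BD_columns_less:
  assumes "odd (length d)" "even (blk d i)" "blk d (i + 1) = 1" "0 < blk d i"
  shows "card (rect_BD t d i \<inter> {(p, q). q \<in> {1..1}}) < blk d i"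
proof (cases "blk d i = 2")
  case True
  have "card (rect_BD t d i) \<le> 1"
    using assms True card_corners_Un_le[of 2 1 0 1] card_corners_Un_le[of 2 1 1 0]
    by (simp add: rect_BD_def Let_def)
  moreover have "card (rect_BD t d i \<inter> {(p, q). q \<in> {1..1}}) \<le> card (rect_BD t d i)"
    by (intro card_mono) auto
  ultimately show ?thesis using True by simp
next
  case False
  then have a: "blk d i > 2" using assms(2,4) by presburger
  then have "rect_BD t d i = upper_right (blk d i) 1 ((blk d i + 1) div 2)
      \<union> lower_left (blk d i) 1 ((blk d i + 1) div 2)"
    using assms by (simp add: rect_BD_def Let_def)
  then show ?thesis
    using card_corners_columns_le[of "blk d i" 1 "(blk d i + 1) div 2" "(blk d i + 1) div 2" 1] a
    by simp
qed

lemma card_central_D_le: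
  "card {(p, q). p \<in> A \<and> q \<in> B \<and> central_D_entry r m p q \<noteq> 0} \<le> m"
proof -
  let ?K = "{1..m div 2}"
  \<comment> \<open>\<open>F\<close> lists the positions of the entries 1 and \<open>G\<close> those
    of the entries -1, one of each per 2 x 2 block.\<close>
  define F G where "F = (\<lambda>k. if odd r then (m + 1 - 2 * k, 2 * k - 1) else (2 * k - 1, m + 1 - 2 * k))"
    and "G = (\<lambda>k. if odd r then (m + 2 - 2 * k, 2 * k) else (2 * k, m + 2 - 2 * k))"
  have "{(p, q). p \<in> A \<and> q \<in> B \<and> central_D_entry r m p q \<noteq> 0} \<subseteq> F ` ?K \<union> G ` ?K"
    by (auto simp: central_D_entry_def F_def G_def split: if_splits)
  then have "card {(p, q). p \<in> A \<and> q \<in> B \<and> central_D_entry r m p q \<noteq> 0} \<le> card (F ` ?K \<union> G ` ?K)"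
    by (intro card_mono) auto
  also have "\<dots> \<le> card ?K + card ?K"
    by (rule order_trans[OF card_Un_le]) (intro add_mono card_image_le; simp)
  also have "\<dots> \<le> m" by simp
  finally show ?thesis .
qed

lemma card_rect_supp_le:
  "card (rect_supp t d k) \<le> blk d k +
    of_bool (t \<in> {Type_B, Type_D} \<and> odd (length d) \<and> odd (blk d k) \<and> even (blk d (k + 1)))"
proof -
  have sub: "card (rect_supp t d k) \<le> card S"
    if "\<And>p q. rect_entry t d k p q = of_bool ((p, q) \<in> S)" "finite S" for S
    using that by (intro card_mono) (auto simp: rect_supp_def)
  consider "t = Type_A" | "t \<noteq> Type_A" "2 * k = length d" "t = Type_C"
    | "t \<noteq> Type_A" "2 * k = length d" "t \<noteq> Type_C"
    | "2 * k \<noteq> length d" "t = Type_C" | "2 * k \<noteq> length d" "t \<in> {Type_B, Type_D}"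
    by (cases t) auto
  then show ?thesis
  proof cases
    case 1
    then show ?thesis
      using sub[of "rect_A k (blk d k) (blk d (k + 1))"] card_rect_A_le[of k "blk d k" "blk d (k + 1)"]
      by (simp add: rect_entry_def)
  next
    case 2
    then show ?thesis
      using sub[of "J_pos (blk d k) 0 0"] card_J_pos_le[of "blk d k" 0 0]
      by (simp add: rect_entry_def)
  next
    case 3
    then have "card (rect_supp t d k) \<le> blk d k"
      using card_central_D_le[of "{1..blk d k}" "{1..blk d (k + 1)}" k "blk d k"]
      by (simp add: rect_supp_def rect_entry_def)
    then show ?thesis by simp
  next
    case 4
    then show ?thesis
      using sub[of "rect_C d k"] card_rect_C_le[of d k] by (simp add: rect_entry_def)
  next
    case 5
    then show ?thesis
      using sub[of "rect_BD t d k"] card_rect_BD_le[of t d k] by (auto simp: rect_entry_def)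
  qed
qed

lemma card_rect_supp_less:
  assumes "t \<in> {Type_B, Type_D}" "odd (length d)" "even (blk d k)" "blk d (k + 1) = 1" "0 < blk d k"
  shows "card (rect_supp t d k) < blk d k"
proof -
  have "2 * k \<noteq> length d" using assms(2) by presburger
  then have "rect_supp t d k \<subseteq> rect_BD t d k \<inter> {(p, q). q \<in> {1..1}}"
    using assms(1,4) by (auto simp: rect_supp_def rect_entry_def)
  then have "card (rect_supp t d k) \<le> card (rect_BD t d k \<inter> {(p, q). q \<in> {1..1}})"
    by (intro card_mono) auto
  then show ?thesis using card_rect_BD_columns_less[OF assms(2-5)] by (rule le_less_trans)
qed

section \<open>Summation\<close>

text \<open>Induction over prefixes, with \<open>a m div 2\<close> as the credit that pays for the
  excesses so far. A descent may destroy credit, so there the prefix is estimated afresh from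
  \<open>before\<close>.\<close>

lemma sum_excess_le:
  fixes a c :: "nat \<Rightarrow> nat"
  assumes pos: "\<And>k. k \<le> r \<Longrightarrow> 1 \<le> a k"
    and c: "\<And>k. k < r \<Longrightarrow> c k \<le> a k + of_bool (odd (a k) \<and> even (a (k + 1)))"
    and one: "\<And>k. k < r \<Longrightarrow> even (a k) \<Longrightarrow> a (k + 1) = 1 \<Longrightarrow> c k < a k"
    and desc: "\<And>l. l < r \<Longrightarrow> a (l + 1) < a l \<Longrightarrow> even (a l)"
    and before: "\<And>i l. l < r \<Longrightarrow> a (l + 1) < a l \<Longrightarrow> i < l \<Longrightarrow> odd (a i) \<Longrightarrow> even (a (i + 1)) \<Longrightarrow>
      i = l - 1"
  shows "(\<Sum>k<r. c k) \<le> (\<Sum>k<r. a k) + a r div 2"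
proof -
  have "m \<le> r \<Longrightarrow> (\<Sum>k<m. c k) \<le> (\<Sum>k<m. a k) + a m div 2" for m
  proof (induction m)
    case 0
    then show ?case by simp
  next
    case (Suc m)
    then have m: "m < r" by simp
    show ?case
    proof (cases "a (m + 1) < a m")
      case False
      \<comment> \<open>Going from an odd to an even length without descending raises the half by at
        least one, which pays for the new excess.\<close>
      then have "of_bool (odd (a m) \<and> even (a (m + 1))) + a m div 2 \<le> a (m + 1) div 2"
        by (cases "odd (a m) \<and> even (a (m + 1))"; simp; presburger)
      then show ?thesis using Suc c[OF m] by simp
    next
      case True
      have le: "c k \<le> a k" if "k < m - 1" for k
      proof -
        have "\<not> (odd (a k) \<and> even (a (k + 1)))"
          using before[OF m True, of k] that by linarith
        then have "of_bool (odd (a k) \<and> even (a (k + 1))) = (0::nat)"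
          by (rule of_bool_eq_0_iff[THEN iffD2])
        then show ?thesis using c[of k] m that by linarith
      qed
      have prefix: "(\<Sum>k<m. c k) \<le> (\<Sum>k<m. a k) + 1"
      proof (cases m)
        case (Suc m')
        have "(\<Sum>k<m'. c k) \<le> (\<Sum>k<m'. a k)" using le Suc by (intro sum_mono) auto
        moreover have "c m' \<le> a m' + 1" using c[of m'] m Suc
          by (cases "odd (a m') \<and> even (a (m' + 1))") auto
        ultimately show ?thesis using Suc by simp
      qed simp
      have ev: "even (a m)" using desc m True by simp
      \<comment> \<open>The spare unit absorbs the excess of the prefix. As \<open>a m\<close> is
        even, \<open>c m\<close> has no excess of its own, and the unit comes from the new credit
        or, if that is 0, from \<open>one\<close>.\<close>
      have "c m + 1 \<le> a m + a (m + 1) div 2"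
      proof (cases "a (m + 1) = 1")
        case True
        then show ?thesis using one[OF m ev] by simp
      next
        case False
        then have "2 \<le> a (m + 1)" using pos[of "m + 1"] m by simp
        then have "1 \<le> a (m + 1) div 2" by simp
        then show ?thesis using c[OF m] ev by simp
      qed
      then show ?thesis using prefix by simp
    qed
  qed
  then show ?thesis by simp
qed

section \<open>Sums of block lengths and the rank\<close>

lemma block_start_eq_sum:
  fixes d :: "nat list"
  shows "k \<le> length d \<Longrightarrow> block_start d k = (\<Sum>i<k. d ! i)"
  by (induction k) (simp_all add: block_start_Suc, simp add: block_start_def)

text \<open>In a palindrome the first and last \<lfloor>length/2\<rfloor> terms have equal sums; the
  prefix up to the start of the last half is computed in two ways.\<close>

lemma sum_first_half:
  fixes d :: "nat list"
  assumes "rev d = d"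
  shows "2 * (\<Sum>k<length d div 2. d ! k) + (if odd (length d) then d ! (length d div 2) else 0) = sum_list d"
proof -
  let ?r = "length d div 2"
  have 1: "block_start d (length d - ?r) = sum_list d - block_start d ?r"
    by (rule block_start_rev) (use assms in auto)
  have 2: "block_start d ?r \<le> sum_list d"
    using block_start_mono[of ?r "length d" d] by (simp add: block_start_def)
  have 3: "block_start d (length d - ?r) =
      block_start d ?r + (if odd (length d) then d ! ?r else 0)"
  proof (cases "odd (length d)")
    case True
    then have "length d - ?r = Suc ?r" "?r < length d" by presburger+
    then show ?thesis using block_start_Suc[of ?r d] True by simp
  next
    case False
    then have "length d - ?r = ?r" by presburger
    then show ?thesis using False by simp
  qed
  have "block_start d ?r = (\<Sum>k<?r. d ! k)" by (rule block_start_eq_sum) simp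
  then show ?thesis using 1 2 3 by linarith
qed

theorem corollary5p5:
  fixes t :: lie_type and n :: nat and d :: "nat list"
  assumes "1 \<le> n"
    and "block_sequence t n d"
    and "nice t n d"
    and "t \<in> {Type_A, Type_C} \<or> (t \<in> {Type_B, Type_D} \<and> \<not> form_star d)"
  shows "finite (S_1 t n d) \<and> card (S_1 t n d) \<le> n"
proof -
  let ?r = "length d div 2"
  define c where "c k = card (rect_supp t d (k + 1))" for k
  note bs = assms(2)
  have N: "sum_list d = mat_size t n" and pos: "\<And>k. k < length d \<Longrightarrow> 1 \<le> d ! k"
    and rev: "t \<noteq> Type_A \<Longrightarrow> rev d = d"
    using bs by (auto simp: block_sequence_def)
  have "d \<noteq> []" using N assms(1) by (cases t) auto
  have c: "c k \<le> d ! k + of_bool (t \<in> {Type_B, Type_D} \<and> odd (length d) \<and>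
      odd (d ! k) \<and> even (d ! (k + 1)))" for k
    using card_rect_supp_le[of t d "k + 1"] by (simp add: c_def blk_def)
  have "(\<Sum>k<num_rects t d. c k) \<le> n"
  \<comment> \<open>Only an orthogonal algebra with an odd number of blocks allows an excess;
    otherwise the block lengths alone give the bound.\<close>
  proof (cases "t \<in> {Type_B, Type_D} \<and> odd (length d)")
    case False
    have "(\<Sum>k<num_rects t d. c k) \<le> (\<Sum>k<num_rects t d. d ! k)"
      using c False by (intro sum_mono) auto
    also have "\<dots> \<le> n"
    proof (cases "t = Type_A")
      case True
      \<comment> \<open>The last block has no rectangle to its right, and its length of at least 1
        accounts for the difference between \<open>n + 1\<close> and \<open>n\<close>.\<close>
      have "sum_list d = (\<Sum>k<length d - 1. d ! k) + d ! (length d - 1)"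
        using block_start_eq_sum[of "length d" d] \<open>d \<noteq> []\<close>
        by (cases "length d") (auto simp: block_start_def)
      then show ?thesis using N True pos[of "length d - 1"] \<open>d \<noteq> []\<close> by (simp add: num_rects_def)
    next
      case tA: False
      have "2 * (\<Sum>k<?r. d ! k) \<le> mat_size t n"
        using sum_first_half[OF rev[OF tA]] N by linarith
      also have "\<dots> \<le> 2 * n + 1" using tA by (cases t) auto
      finally show ?thesis using tA by (simp add: num_rects_def)
    qed
    finally show ?thesis .
  next
    case True
    then have tBD: "t \<in> {Type_B, Type_D}" and odd: "odd (length d)" by auto
    then have tA: "t \<noteq> Type_A" by auto
    have "\<not> form_star d" using assms(4) tBD by auto
    then have descent: "\<not> (1 \<le> l \<and> l \<le> ?r \<and> blk d (l + 1) < blk d l \<and>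
          (\<exists>i. 1 \<le> i \<and> i < l \<and> odd (blk d i) \<and> even (blk d (i + 1)) \<and>
             (i = l - 1 \<longrightarrow> blk d (l - 1) < blk d (l + 1))))"
      "\<not> (1 \<le> l \<and> l \<le> ?r \<and> blk d (l + 1) < blk d l \<and> odd (blk d l))" for l
      using odd unfolding form_star_def Let_def by blast+
    have "(\<Sum>k<?r. c k) \<le> (\<Sum>k<?r. d ! k) + d ! ?r div 2"
    proof (rule sum_excess_le)
      show "1 \<le> d ! k" if "k \<le> ?r" for k using pos that \<open>d \<noteq> []\<close>
        by (simp add: order.strict_trans1)
      show "c k \<le> d ! k + of_bool (odd (d ! k) \<and> even (d ! (k + 1)))" if "k < ?r" for k
        using c tBD odd by auto
      show "c k < d ! k" if "k < ?r" "even (d ! k)" "d ! (k + 1) = 1" for k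
      proof -
        have "0 < d ! k" using pos[of k] that(1) by linarith
        then show ?thesis
          using card_rect_supp_less[OF tBD odd, of "k + 1"] that by (simp add: c_def blk_def)
      qed
      show "even (d ! l)" if "l < ?r" "d ! (l + 1) < d ! l" for l
        using descent(2)[of "l + 1"] that by (simp add: blk_def)
      show "i = l - 1"
        if "l < ?r" "d ! (l + 1) < d ! l" "i < l" "odd (d ! i)" "even (d ! (i + 1))" for i l
      proof (rule ccontr)
        assume "i \<noteq> l - 1"
        then have "i + 1 \<noteq> l + 1 - 1" using that(3) by linarith
        then have "1 \<le> i + 1 \<and> i + 1 < l + 1 \<and> odd (blk d (i + 1)) \<and> even (blk d (i + 1 + 1)) \<and>
            (i + 1 = l + 1 - 1 \<longrightarrow> blk d (l + 1 - 1) < blk d (l + 1 + 1))"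
          using that by (simp add: blk_def)
        moreover have "1 \<le> l + 1 \<and> l + 1 \<le> ?r \<and> blk d (l + 1 + 1) < blk d (l + 1)"
          using that by (simp add: blk_def)
        ultimately show False using descent(1)[of "l + 1"] by blast
      qed
    qed
    \<comment> \<open>Twice the bound is at most \<open>mat_size t n\<close>, hence at most
      \<open>2 * n + 1\<close>, and integrality gives \<open>n\<close>.\<close>
    moreover have "2 * (\<Sum>k<?r. d ! k) + d ! ?r = mat_size t n"
      using sum_first_half[OF rev[OF tA]] N odd by simp
    moreover have "mat_size t n \<le> 2 * n + 1" by (cases t) auto
    ultimately show ?thesis using tA by (simp add: num_rects_def)
  qed
  then show ?thesis using S_1_card[OF bs] by (simp add: c_def)
qed

end
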